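(* Let $p(x,y,z)$ and $q(x,y,z)$ be linearly independent homogeneous polynomials of degree two with complex coefficients. Suppose there exist four pairwise noncollinear vectors $(\alpha_i,\beta_i)\in\mathbb{C}^2$, $i=1,\dots,4$, such that each of the polynomials $r_i(x,y,z)=\alpha_ip(x,y,z)+\beta_iq(x,y,z)$ is factorizable. Then at least one of the following conditions holds: (a) $p$ and $q$ have a common factor of first degree: $p=\ell\,\ell_1$ and $q=\ell\,\ell_2$ for some $\ell,\ell_1,\ell_2\in\dot\Pi_1^3$; (b) $p(x,y,z)=f(s,t)$ and $q(x,y,z)=g(s,t)$, where $f,g\in\dot\Pi_2^2$ are bivariate homogeneous polynomials of degree two and $s=a_1x+b_1y+c_1z$, $t=a_2x+b_2y+c_2z$ for some $a_i,b_i,c_i\in\mathbb{C}$; and therefore, for all $\alpha,\beta\in\mathbb{C}$, the polynomial $r(x,y,z)=\alpha p(x,y,z)+\beta q(x,y,z)$ is factorizable.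
   Context: All polynomials have complex coefficients. $\dot\Pi_n^k$ denotes the vector space of homogeneous polynomials of degree $n$ in $k$ variables with complex coefficients (including the zero polynomial); e.g. $\dot\Pi_n^3=\{\sum_{i+j+k=n}a_{ijk}x^iy^jz^k\}$. A polynomial in $\dot\Pi_2^3$ is factorizable if it equals $m_1m_2$ with $m_1,m_2\in\dot\Pi_1^3$; in particular, the zero polynomial counts as factorizable. Two vectors in $\mathbb{C}^2$ are noncollinear if they are linearly independent over $\mathbb{C}$. *)

theory Defs
  imports "HOL-Library.Poly_Mapping" "HOL-Analysis.Analysis"
begin

text \<open>
  Polynomials over the complex numbers: finitely supported functions from exponent vectors to
  coefficients, with the convolution product. Variables are numbered from 0, so \<open>x, y, z\<close>
  are \<open>Var 0, Var 1, Var 2\<close>.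
\<close>

type_synonym cpoly = "(nat \<Rightarrow>\<^sub>0 nat) \<Rightarrow>\<^sub>0 complex"

definition Const :: "complex \<Rightarrow> cpoly" where
  "Const c = Poly_Mapping.single 0 c"

definition Var :: "nat \<Rightarrow> cpoly" where
  "Var i = Poly_Mapping.single (Poly_Mapping.single i 1) 1"

definition pscale :: "complex \<Rightarrow> cpoly \<Rightarrow> cpoly" where
  "pscale c p = Const c * p"

global_interpretation cpoly: vector_space pscale
  by unfold_locales
    (simp_all add: pscale_def Const_def single_add distrib_left distrib_right
      mult_single mult.assoc[symmetric] flip: single_one)

definition mdegree :: "(nat \<Rightarrow>\<^sub>0 nat) \<Rightarrow> nat" where
  "mdegree m = (\<Sum>i\<in>Poly_Mapping.keys m. Poly_Mapping.lookup m i)"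

text \<open>Forms of degree \<open>n\<close> in the first \<open>k\<close> variables, including the zero polynomial.\<close>

definition forms :: "nat \<Rightarrow> nat \<Rightarrow> cpoly set" where
  "forms n k =
     {p. \<forall>m\<in>Poly_Mapping.keys p. Poly_Mapping.keys m \<subseteq> {..<k} \<and> mdegree m = n}"

definition factorizable :: "cpoly \<Rightarrow> bool" where
  "factorizable p \<longleftrightarrow> (\<exists>m1\<in>forms 1 3. \<exists>m2\<in>forms 1 3. p = m1 * m2)"

definition subst :: "(nat \<Rightarrow> cpoly) \<Rightarrow> cpoly \<Rightarrow> cpoly" where
  "subst \<sigma> f =
     (\<Sum>m\<in>Poly_Mapping.keys f. Const (Poly_Mapping.lookup f m) *
        (\<Prod>i\<in>Poly_Mapping.keys m. \<sigma> i ^ Poly_Mapping.lookup m i))"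

text \<open>The value is used only for \<open>f\<close> in \<open>forms n 2\<close>, where no variable beyond
  \<open>Var 1\<close> occurs.\<close>

definition subst2 :: "cpoly \<Rightarrow> cpoly \<Rightarrow> cpoly \<Rightarrow> cpoly" where
  "subst2 f s t = subst (\<lambda>i. if i = 0 then s else t) f"

text \<open>Independence in the library is a property of sets, so for the pair \<open>u, v\<close> the condition
  \<open>u \<noteq> v\<close> has to be added.\<close>

definition noncollinear :: "complex ^ 2 \<Rightarrow> complex ^ 2 \<Rightarrow> bool" where
  "noncollinear u v \<longleftrightarrow> u \<noteq> v \<and> vec.independent {u, v}"

definition lin_indep :: "cpoly \<Rightarrow> cpoly \<Rightarrow> bool" where
  "lin_indep p q \<longleftrightarrow> p \<noteq> q \<and> cpoly.independent {p, q}"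

definition common_linear_factor :: "cpoly \<Rightarrow> cpoly \<Rightarrow> bool" where
  "common_linear_factor p q \<longleftrightarrow>
     (\<exists>l\<in>forms 1 3. \<exists>l1\<in>forms 1 3. \<exists>l2\<in>forms 1 3. p = l * l1 \<and> q = l * l2)"

definition common_bivariate_form :: "cpoly \<Rightarrow> cpoly \<Rightarrow> bool" where
  "common_bivariate_form p q \<longleftrightarrow>
     (\<exists>f\<in>forms 2 2. \<exists>g\<in>forms 2 2. \<exists>a1 b1 c1 a2 b2 c2 s t.
        s = pscale a1 (Var 0) + pscale b1 (Var 1) + pscale c1 (Var 2) \<and>
        t = pscale a2 (Var 0) + pscale b2 (Var 1) + pscale c2 (Var 2) \<and>
        p = subst2 f s t \<and> q = subst2 g s t)"

end

theory Submission imports Defs begin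

text \<open>
  A form \<open>r\<close> of degree two in \<open>x, y, z\<close> has a discriminant, the determinant of its Hessian matrix up to
  a factor, and this vanishes if \<open>r\<close> is factorizable. Choose the first two factorizable members
  \<open>r\<^sub>1 = u v\<close> and \<open>r\<^sub>2 = u' v'\<close> as generators of the pencil. As both end points have discriminant 0, the
  discriminant of \<open>a r\<^sub>1 + b r\<^sub>2\<close>, a binary cubic in \<open>a, b\<close>, is divisible by \<open>a b\<close>. The quotient is
  linear and can be written down with \<open>3 \<times> 3\<close> determinants of coefficient vectors
  (\<open>discriminant_pencil\<close>): up to sign it is
  \<open>a [u v u'] [u v v'] + b [u u' v'] [v u' v']\<close>.
  The remaining two factorizable members are zeros of this linear form at two different points of the
  projective line, so both products of brackets vanish.

  In the projective plane, a bracket is zero iff the three lines are concurrent. Hence a line of one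
  pair and a line of the other, say \<open>u = 0\<close> and \<open>u' = 0\<close>, are concurrent with \<open>v = 0\<close>
  and also with \<open>v' = 0\<close> (\<open>coplanar_cases\<close>, up to renaming). If \<open>u\<close> and \<open>u'\<close> are proportional,
  they are a common factor of \<open>r\<^sub>1\<close> and \<open>r\<^sub>2\<close>. Otherwise \<open>v\<close> and \<open>v'\<close> are linear combinations of \<open>u\<close> and
  \<open>u'\<close>, so that \<open>r\<^sub>1\<close> and \<open>r\<^sub>2\<close> are forms in \<open>u\<close> and \<open>u'\<close> (\<open>two_coplanar_triples\<close>).

  Both properties pass from \<open>r\<^sub>1, r\<^sub>2\<close> to all linear combinations, among them \<open>p\<close> and \<open>q\<close>, and both make
  every member of the pencil factorizable, the second one because a binary form over the complex numbers
  splits into linear factors (\<open>factorizable_binary_quadratic\<close>).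
\<close>


section \<open>Forms and their coefficients\<close>

lemma Const_add: "Const (a + b) = Const a + Const b" by (simp add: Const_def single_add)
lemma Const_mult: "Const (a * b) = Const a * Const b" by (simp add: Const_def mult_single)
lemma Const_0: "Const 0 = 0" by (simp add: Const_def)
lemma Const_1: "Const 1 = 1" by (simp add: Const_def)

text \<open>
  Serves twice: for a polynomial as the sum of its terms, and for an exponent vector as the sum of its
  entries.
\<close>

lemma poly_mapping_sum_single:
  assumes "finite A" "Poly_Mapping.keys p \<subseteq> A"
  shows "p = (\<Sum>m\<in>A. Poly_Mapping.single m (Poly_Mapping.lookup p m))"
proof (rule poly_mapping_eqI)
  fix k
  have "(\<Sum>m\<in>A. Poly_Mapping.lookup (Poly_Mapping.single m (Poly_Mapping.lookup p m)) k)
      = (\<Sum>m\<in>A. if m = k then Poly_Mapping.lookup p k else 0)"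
    by (intro sum.cong) (auto simp: lookup_single)
  then show "Poly_Mapping.lookup p k
      = Poly_Mapping.lookup (\<Sum>m\<in>A. Poly_Mapping.single m (Poly_Mapping.lookup p m)) k"
    using assms by (auto simp: lookup_sum in_keys_iff)
qed

lemma pscale_single [simp]: "pscale c (Poly_Mapping.single m a) = Poly_Mapping.single m (c * a)"
  by (simp add: pscale_def Const_def mult_single)

lemma lookup_pscale [simp]: "Poly_Mapping.lookup (pscale c p) m = c * Poly_Mapping.lookup p m"
  by (simp add: pscale_def Const_def map.rep_eq when_def flip: mult_map_scale_conv_mult)

lemma mdegree_superset:
  assumes "finite A" "Poly_Mapping.keys m \<subseteq> A"
  shows "mdegree m = (\<Sum>i\<in>A. Poly_Mapping.lookup m i)"
  unfolding mdegree_def using assms by (intro sum.mono_neutral_left) (auto simp: in_keys_iff)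

lemma mdegree_add: "mdegree (m + m') = mdegree m + mdegree m'"
  using keys_add[of m m'] mdegree_superset[of "Poly_Mapping.keys m \<union> Poly_Mapping.keys m'"]
  by (simp add: lookup_add sum.distrib)

lemma mdegree_single [simp]: "mdegree (Poly_Mapping.single i n) = n"
  by (cases "n = 0") (simp_all add: mdegree_def)

lemma forms_add: "p \<in> forms n k \<Longrightarrow> q \<in> forms n k \<Longrightarrow> p + q \<in> forms n k"
  unfolding forms_def using keys_add[of p q] by blast

lemma forms_pscale: "p \<in> forms n k \<Longrightarrow> pscale c p \<in> forms n k"
  unfolding forms_def by (auto simp: in_keys_iff)

lemma Var_mult_Var:
  "Var i * Var j = Poly_Mapping.single (Poly_Mapping.single i 1 + Poly_Mapping.single j 1) 1"
  by (simp add: Var_def mult_single)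

lemma pair_monomial_eq_iff:
  "Poly_Mapping.single i 1 + Poly_Mapping.single j 1
     = Poly_Mapping.single k 1 + (Poly_Mapping.single l 1 :: nat \<Rightarrow>\<^sub>0 nat)
   \<longleftrightarrow> (i = k \<and> j = l) \<or> (i = l \<and> j = k)"
  (is "?L = ?R \<longleftrightarrow> _")
proof
  assume "?L = ?R"
  then have "Poly_Mapping.lookup ?L x = Poly_Mapping.lookup ?R x" for x by simp
  from this[of i] this[of j] this[of k] this[of l] show "(i = k \<and> j = l) \<or> (i = l \<and> j = k)"
    by (auto simp: lookup_add lookup_single when_def split: if_splits)
qed (auto simp: add.commute)

definition linear_form :: "complex ^ 3 \<Rightarrow> cpoly" where
  "linear_form u = pscale (u $ 1) (Var 0) + pscale (u $ 2) (Var 1) + pscale (u $ 3) (Var 2)"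

lemma linear_form_add: "linear_form (u + v) = linear_form u + linear_form v"
  by (simp add: linear_form_def pscale_def Const_add algebra_simps)

lemma linear_form_scale: "linear_form (c *s u) = pscale c (linear_form u)"
  by (simp add: linear_form_def pscale_def Const_mult algebra_simps)

lemma linear_form_0: "linear_form 0 = 0"
  by (simp add: linear_form_def)

lemma forms_1_3: "forms 1 3 = range linear_form"
proof (intro equalityI subsetI)
  fix p assume p: "p \<in> forms 1 3"
  define e where "e i = Poly_Mapping.single i (1::nat)" for i :: nat
  have e_eq: "e i = e j \<longleftrightarrow> i = j" for i j
    by (metis e_def lookup_single_eq lookup_single_not_eq one_neq_zero)
  have "m \<in> {e 0, e 1, e 2}" if "m \<in> Poly_Mapping.keys p" for m
  proof -
    from p that have m: "Poly_Mapping.keys m \<subseteq> {..<3}" "mdegree m = 1"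
      by (auto simp: forms_def)
    have "Poly_Mapping.lookup m 0 + Poly_Mapping.lookup m 1 + Poly_Mapping.lookup m 2 = 1"
      using mdegree_superset[OF _ m(1)] m(2) by (simp add: eval_nat_numeral)
    moreover have "m = Poly_Mapping.single 0 (Poly_Mapping.lookup m 0)
        + Poly_Mapping.single 1 (Poly_Mapping.lookup m 1) + Poly_Mapping.single 2 (Poly_Mapping.lookup m 2)"
      using poly_mapping_sum_single[OF _ m(1)] by (simp add: eval_nat_numeral)
    ultimately show ?thesis
      unfolding e_def by (auto simp: add_is_1)
  qed
  then have "p = (\<Sum>m\<in>{e 0, e 1, e 2}. Poly_Mapping.single m (Poly_Mapping.lookup p m))"
    by (intro poly_mapping_sum_single) auto
  also have "\<dots> = linear_form (vector [Poly_Mapping.lookup p (e 0), Poly_Mapping.lookup p (e 1),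
      Poly_Mapping.lookup p (e 2)])"
    by (simp add: linear_form_def Var_def e_eq add.assoc flip: e_def One_nat_def)
  finally show "p \<in> range linear_form" by blast
next
  fix p assume "p \<in> range linear_form"
  moreover have "Var i \<in> forms 1 3" if "i < 3" for i
    using that by (auto simp: forms_def Var_def mdegree_def)
  ultimately show "p \<in> forms 1 3"
    by (auto simp: linear_form_def intro!: forms_add forms_pscale)
qed

section \<open>Bivariate forms in two linear forms\<close>

text \<open>
  The sum in \<open>subst\<close> ranges over the support of the polynomial. A larger range that does not depend on
  it is what makes additivity visible.
\<close>

lemma subst_superset:
  assumes "finite A" "Poly_Mapping.keys f \<subseteq> A"
  shows "subst \<sigma> f = (\<Sum>m\<in>A. Const (Poly_Mapping.lookup f m) *
           (\<Prod>i\<in>Poly_Mapping.keys m. \<sigma> i ^ Poly_Mapping.lookup m i))"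
  unfolding subst_def using assms
  by (intro sum.mono_neutral_left) (auto simp: in_keys_iff Const_0)

lemma subst_add: "subst \<sigma> (f + g) = subst \<sigma> f + subst \<sigma> g"
proof -
  let ?A = "Poly_Mapping.keys f \<union> Poly_Mapping.keys g"
  show ?thesis
    using subst_superset[of ?A "f + g" \<sigma>] subst_superset[of ?A f \<sigma>] subst_superset[of ?A g \<sigma>]
      keys_add[of f g]
    by (simp add: lookup_add Const_add distrib_right sum.distrib)
qed

lemma subst_pscale: "subst \<sigma> (pscale c f) = pscale c (subst \<sigma> f)"
proof -
  have "Poly_Mapping.keys (pscale c f) \<subseteq> Poly_Mapping.keys f"
    by (auto simp: in_keys_iff)
  from subst_superset[OF _ this] show ?thesis
    by (simp only: subst_def[of \<sigma> f] lookup_pscale finite_keys Const_mult sum_distrib_left)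
      (simp add: pscale_def sum_distrib_left mult.assoc)
qed

definition binary_quadratic :: "complex \<Rightarrow> complex \<Rightarrow> complex \<Rightarrow> cpoly" where
  "binary_quadratic a b c =
     pscale a (Var 0 * Var 0) + pscale b (Var 0 * Var 1) + pscale c (Var 1 * Var 1)"

lemma forms_2_2: "forms 2 2 = {binary_quadratic a b c | a b c. True}"
proof (intro equalityI subsetI)
  fix f assume f: "f \<in> forms 2 2"
  define e where "e i j = (Poly_Mapping.single i 1 + Poly_Mapping.single j 1 :: nat \<Rightarrow>\<^sub>0 nat)" for i j
  have e_eq: "e i j = e k l \<longleftrightarrow> (i = k \<and> j = l) \<or> (i = l \<and> j = k)" for i j k l
    unfolding e_def by (rule pair_monomial_eq_iff)
  have e_diag: "e i i = Poly_Mapping.single i 2" for i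
    by (simp add: e_def flip: single_add One_nat_def del: single_numeral)
  have "m \<in> {e 0 0, e 0 1, e 1 1}" if "m \<in> Poly_Mapping.keys f" for m
  proof -
    from f that have m: "Poly_Mapping.keys m \<subseteq> {..<2}" "mdegree m = 2"
      by (auto simp: forms_def)
    have "Poly_Mapping.lookup m 0 + Poly_Mapping.lookup m 1 = 2"
      using mdegree_superset[OF _ m(1)] m(2) by (simp add: eval_nat_numeral)
    moreover have eq: "m = Poly_Mapping.single 0 (Poly_Mapping.lookup m 0)
        + Poly_Mapping.single 1 (Poly_Mapping.lookup m 1)"
      using poly_mapping_sum_single[OF _ m(1)] by (simp add: eval_nat_numeral)
    ultimately consider "Poly_Mapping.lookup m 0 = 2" "Poly_Mapping.lookup m 1 = 0"
      | "Poly_Mapping.lookup m 0 = 1" "Poly_Mapping.lookup m 1 = 1"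
      | "Poly_Mapping.lookup m 0 = 0" "Poly_Mapping.lookup m 1 = 2"
      by linarith
    then show ?thesis
      by cases (use eq in \<open>simp_all add: e_diag e_def del: single_numeral single_one One_nat_def\<close>)
  qed
  then have "f = (\<Sum>m\<in>{e 0 0, e 0 1, e 1 1}. Poly_Mapping.single m (Poly_Mapping.lookup f m))"
    by (intro poly_mapping_sum_single) auto
  also have "\<dots> = binary_quadratic (Poly_Mapping.lookup f (e 0 0)) (Poly_Mapping.lookup f (e 0 1))
      (Poly_Mapping.lookup f (e 1 1))"
    by (simp add: binary_quadratic_def Var_mult_Var e_eq add.assoc flip: One_nat_def e_def del: single_one single_numeral)
  finally show "f \<in> {binary_quadratic a b c | a b c. True}" by blast
next
  fix f assume "f \<in> {binary_quadratic a b c | a b c. True}"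
  moreover have "Var i * Var j \<in> forms 2 2" if "i < 2" "j < 2" for i j
    using that
    by (auto simp: forms_def Var_mult_Var mdegree_add in_keys_iff lookup_add lookup_single
        when_def split: if_splits)
  ultimately show "f \<in> forms 2 2"
    by (auto simp: binary_quadratic_def intro!: forms_add forms_pscale)
qed

lemma subst2_binary_quadratic:
  "subst2 (binary_quadratic a b c) s t =
     pscale a (s * s) + pscale b (s * t) + pscale c (t * t)"
proof -
  have *: "subst2 (Var i * Var j) s t = (if i = 0 then s else t) * (if j = 0 then s else t)" for i j
  proof -
    have "Poly_Mapping.keys (Poly_Mapping.single i (1::nat) + Poly_Mapping.single j 1) = {i, j}"
      by (auto simp: in_keys_iff lookup_add lookup_single when_def split: if_splits)
    then show ?thesis
    unfolding subst2_def Var_mult_Var subst_def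
    by (cases "i = j") (simp_all add: Const_1 lookup_add lookup_single when_def power2_eq_square)
  qed
  show ?thesis
    unfolding binary_quadratic_def
    using *[of 0 0] *[of 0 1] *[of 1 1] by (simp add: subst2_def subst_add subst_pscale)
qed

text \<open>
  The quadratic formula: if \<open>r\<close> is a root of \<open>a X\<^sup>2 - b X + c\<close>, then
  \<open>a s\<^sup>2 + b s t + c t\<^sup>2 = (s + r t) (a s + (b - a r) t)\<close>. Working with \<open>r\<close> rather than the root
  \<open>- r\<close> of \<open>a X\<^sup>2 + b X + c\<close> keeps differences of linear forms out of the factors. For \<open>a = 0\<close> the factor \<open>t\<close> is explicit.
\<close>

lemma factorizable_binary_quadratic:
  fixes s t :: "complex ^ 3"
  shows "factorizable (subst2 (binary_quadratic a b c) (linear_form s) (linear_form t))"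
proof (cases "a = 0")
  case True
  then have "subst2 (binary_quadratic a b c) (linear_form s) (linear_form t)
      = linear_form t * linear_form (b *s s + c *s t)"
    by (simp add: subst2_binary_quadratic linear_form_add linear_form_scale pscale_def Const_0 algebra_simps)
  then show ?thesis unfolding factorizable_def forms_1_3 by blast
next
  case False
  define r where "r = (b - csqrt (b\<^sup>2 - 4 * a * c)) / (2 * a)"
  have "(b - 2 * a * r)\<^sup>2 = b\<^sup>2 - 4 * a * c"
    using False by (simp add: r_def)
  then have "4 * a * (a * r\<^sup>2 - b * r + c) = 0" by algebra
  with False have "a * r\<^sup>2 - b * r + c = 0" by simp
  then have c: "c = r * (b - a * r)" by algebra
  have "b = a * r + (b - a * r)" by simp
  then have b: "Const b = Const a * Const r + Const (b - a * r)"
    by (metis Const_add Const_mult)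
  have "subst2 (binary_quadratic a b c) (linear_form s) (linear_form t)
      = linear_form (s + r *s t) * linear_form (a *s s + (b - a * r) *s t)"
    unfolding subst2_binary_quadratic linear_form_add linear_form_scale pscale_def b
    unfolding c Const_mult by (simp only: algebra_simps)
  then show ?thesis unfolding factorizable_def forms_1_3 by blast
qed

section \<open>Invariance under change of generators of the pencil\<close>

lemma common_bivariate_form_iff:
  "common_bivariate_form p q \<longleftrightarrow>
     (\<exists>f\<in>forms 2 2. \<exists>g\<in>forms 2 2. \<exists>s t.
        p = subst2 f (linear_form s) (linear_form t) \<and> q = subst2 g (linear_form s) (linear_form t))"
  (is "?L \<longleftrightarrow> ?R")
proof
  assume ?L
  then obtain f g a1 b1 c1 a2 b2 c2 where "f \<in> forms 2 2" "g \<in> forms 2 2"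
    "p = subst2 f (linear_form (vector [a1, b1, c1])) (linear_form (vector [a2, b2, c2]))"
    "q = subst2 g (linear_form (vector [a1, b1, c1])) (linear_form (vector [a2, b2, c2]))"
    unfolding common_bivariate_form_def by (auto simp: linear_form_def)
  then show ?R by blast
next
  assume ?R
  then show ?L unfolding common_bivariate_form_def linear_form_def by blast
qed

lemma common_linear_factor_pencil:
  assumes "common_linear_factor p q"
  shows "common_linear_factor (pscale a p + pscale b q) (pscale c p + pscale d q)"
proof -
  from assms obtain l l1 l2 where "l \<in> forms 1 3" "l1 \<in> forms 1 3" "l2 \<in> forms 1 3"
    "p = l * l1" "q = l * l2" unfolding common_linear_factor_def by blast
  moreover from this have "pscale x p + pscale y q = l * (pscale x l1 + pscale y l2)" for x y
    by (simp add: pscale_def algebra_simps)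
  ultimately show ?thesis
    unfolding common_linear_factor_def by (blast intro: forms_add forms_pscale)
qed

lemma common_bivariate_form_pencil:
  assumes "common_bivariate_form p q"
  shows "common_bivariate_form (pscale a p + pscale b q) (pscale c p + pscale d q)"
proof -
  from assms obtain f g s t where "f \<in> forms 2 2" "g \<in> forms 2 2"
    "p = subst2 f (linear_form s) (linear_form t)" "q = subst2 g (linear_form s) (linear_form t)"
    unfolding common_bivariate_form_iff by blast
  moreover from this have "pscale x p + pscale y q
      = subst2 (pscale x f + pscale y g) (linear_form s) (linear_form t)" for x y
    by (simp add: subst2_def subst_add subst_pscale)
  ultimately show ?thesis
    unfolding common_bivariate_form_iff by (blast intro: forms_add forms_pscale)
qed

lemma factorizable_pencil:
  assumes "common_linear_factor p q \<or> common_bivariate_form p q"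
  shows "factorizable (pscale a p + pscale b q)"
  using assms
proof
  assume "common_linear_factor p q"
  then show ?thesis
    using common_linear_factor_pencil[of p q a b a b]
    unfolding common_linear_factor_def factorizable_def by blast
next
  assume "common_bivariate_form p q"
  then obtain f s t where "f \<in> forms 2 2"
    "pscale a p + pscale b q = subst2 f (linear_form s) (linear_form t)"
    using common_bivariate_form_pencil[of p q a b a b] unfolding common_bivariate_form_iff by blast
  then show ?thesis
    unfolding forms_2_2 using factorizable_binary_quadratic by auto
qed

section \<open>The discriminant of a pencil\<close>

lemma factorizable_pscale: "factorizable p \<Longrightarrow> factorizable (pscale c p)"
  unfolding factorizable_def
  by (metis forms_pscale pscale_def mult.assoc)

text \<open>
  This is half the determinant of the Hessian matrix of a form of degree two, that is, four times the
  determinant of the symmetric matrix of the form.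
\<close>

definition discriminant :: "cpoly \<Rightarrow> complex" where
  "discriminant p = (let c = (\<lambda>i j. Poly_Mapping.lookup p (Poly_Mapping.single i 1 + Poly_Mapping.single j 1))
    in 4 * c 0 0 * c 1 1 * c 2 2 + c 0 1 * c 0 2 * c 1 2
       - c 0 0 * c 1 2 ^ 2 - c 1 1 * c 0 2 ^ 2 - c 2 2 * c 0 1 ^ 2)"

text \<open>
  The functions \<open>U\<close> and \<open>V\<close> renumber the coordinates of \<open>u\<close> and \<open>v\<close>: the variables
  count from 0, the coordinates from 1.
\<close>

lemma lookup_linear_form_mult:
  "Poly_Mapping.lookup (linear_form u * linear_form v) (Poly_Mapping.single i 1 + Poly_Mapping.single j 1) =
   (let U = (\<lambda>k. if k = 0 then u $ 1 else if k = 1 then u $ 2 else if k = (2::nat) then u $ 3 else 0);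
        V = (\<lambda>k. if k = 0 then v $ 1 else if k = 1 then v $ 2 else if k = (2::nat) then v $ 3 else 0)
    in if i = j then U i * V i else U i * V j + U j * V i)"
proof -
  have "linear_form u * linear_form v =
     pscale (u$1 * v$1) (Var 0 * Var 0) + pscale (u$1 * v$2) (Var 0 * Var 1) + pscale (u$1 * v$3) (Var 0 * Var 2)
   + pscale (u$2 * v$1) (Var 1 * Var 0) + pscale (u$2 * v$2) (Var 1 * Var 1) + pscale (u$2 * v$3) (Var 1 * Var 2)
   + pscale (u$3 * v$1) (Var 2 * Var 0) + pscale (u$3 * v$2) (Var 2 * Var 1) + pscale (u$3 * v$3) (Var 2 * Var 2)"
    by (simp add: linear_form_def pscale_def Const_mult algebra_simps)
  then show ?thesis
    unfolding Var_mult_Var by (simp only: lookup_add lookup_pscale lookup_single pair_monomial_eq_iff when_def Let_def) auto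
qed

text \<open>
  By the Cauchy-Binet formula, applied to the factorization of the symmetric matrix of the pencil through
  the \<open>3 \<times> 4\<close> matrix with columns \<open>u, v, u', v'\<close>. The discriminant is cubic in \<open>(a, b)\<close>, but
  \<open>a\<^sup>3\<close> and \<open>b\<^sup>3\<close> do not occur since the two generators are factorizable.
\<close>

lemma discriminant_pencil:
  "discriminant (pscale a (linear_form u * linear_form v) + pscale b (linear_form u' * linear_form v')) =
   - a * b * (a * det (vector [u, v, u']) * det (vector [u, v, v'])
            + b * det (vector [u, u', v']) * det (vector [v, u', v']))"
  unfolding discriminant_def lookup_add lookup_pscale lookup_linear_form_mult Let_def det_3 vector_3
  by simp algebra

lemma discriminant_factorizable: "factorizable p \<Longrightarrow> discriminant p = 0"
  unfolding factorizable_def forms_1_3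
  using discriminant_pencil[where a=1 and b=0]
  by auto

section \<open>Linear dependence in dimensions two and three\<close>

text \<open>
  If all \<open>2 \<times> 2\<close> minors of \<open>u, v\<close> vanish, the two vectors are proportional; otherwise Cramer's rule
  with a nonzero minor expresses \<open>w\<close>.
\<close>

lemma det_0_imp_in_span:
  fixes u v w :: "complex ^ 3"
  assumes "u \<noteq> 0" and det: "det (vector [u, v, w]) = 0"
  shows "(\<exists>k. v = k *s u) \<or> (\<exists>a b. w = a *s u + b *s v)"
proof -
  define d where "d i j = u $ i * v $ j - u $ j * v $ i" for i j
  show ?thesis
  proof (cases "\<forall>i j. d i j = 0")
    case True
    from \<open>u \<noteq> 0\<close> obtain i where "u $ i \<noteq> 0" by (auto simp: vec_eq_iff)
    with True have "v = (v $ i / u $ i) *s u"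
      by (auto simp: vec_eq_iff field_simps d_def)
    then show ?thesis by blast
  next
    case False
    then obtain i j where ij: "d i j \<noteq> 0" by blast
    have "d i j * w $ k = (w $ i * v $ j - w $ j * v $ i) * u $ k + (u $ i * w $ j - u $ j * w $ i) * v $ k"
      for k
    proof (cases "k = i \<or> k = j \<or> i = j")
      case True
      then show ?thesis unfolding d_def by (elim disjE) (simp_all add: algebra_simps)
    next
      case False
      \<comment> \<open>Now \<open>i, j, k\<close> are the three rows in some order, and \<open>e\<close> is up to sign the expansion
        along row \<open>k\<close> of the determinant with columns \<open>u, v, w\<close>.\<close>
      define e where "e = d i j * w $ k
          - ((w $ i * v $ j - w $ j * v $ i) * u $ k + (u $ i * w $ j - u $ j * w $ i) * v $ k)"
      have "e = det (vector [u, v, w]) \<or> e = - det (vector [u, v, w])"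
        using False exhaust_3[of i] exhaust_3[of j] exhaust_3[of k]
        unfolding e_def d_def det_3 vector_3 by (elim disjE; simp add: algebra_simps)
      then show ?thesis using det by (auto simp: e_def)
    qed
    then have "w = ((w $ i * v $ j - w $ j * v $ i) / d i j) *s u
                 + ((u $ i * w $ j - u $ j * w $ i) / d i j) *s v"
      using ij by (simp add: vec_eq_iff divide_simps mult.commute[of "d i j"])
    then show ?thesis by blast
  qed
qed

lemma (in vector_space) independent_pairD:
  assumes "independent {u, v}" "u \<noteq> v" "scale a u + scale b v = 0"
  shows "a = 0 \<and> b = 0"
proof -
  let ?c = "\<lambda>x. if x = u then a else b"
  have "(\<Sum>x\<in>{u, v}. scale (?c x) x) = 0" using assms(2,3) by simp
  then have "?c u = 0 \<and> ?c v = 0"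
    using independentD[OF assms(1), of "{u, v}" ?c] by blast
  then show ?thesis using assms(2) by simp
qed

lemma noncollinear_det:
  assumes "noncollinear (vector [a, b]) (vector [c, d])"
  shows "a * d - c * b \<noteq> 0"
proof
  assume 0: "a * d - c * b = 0"
  let ?u = "vector [a, b] :: complex ^ 2" and ?v = "vector [c, d] :: complex ^ 2"
  have eq: "x = 0 \<and> y = 0" if "x *s ?u + y *s ?v = 0" for x y
    using assms that unfolding noncollinear_def by (blast dest: vec.independent_pairD)
  have "?u = ?v"
    using eq[of d "- b"] eq[of c "- a"] 0 by (simp add: vec_eq_iff forall_2 vector_2 algebra_simps)
  with assms show False by (simp add: noncollinear_def)
qed

lemma det_swap: "det (vector [u, v, w]) = 0 \<longleftrightarrow> det (vector [u, w, v :: complex ^ 3]) = 0"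
  unfolding det_3 vector_3 by (auto; algebra)

lemma det_rotate: "det (vector [u, v, w]) = det (vector [v, w, u :: complex ^ 3])"
  unfolding det_3 vector_3 by algebra

section \<open>From concurrent lines to a common structure\<close>

text \<open>
  The pair \<open>u, u'\<close> of one factor from each product decides: proportional vectors give a common factor,
  and independent ones span both \<open>v\<close> and \<open>v'\<close>.
\<close>

lemma two_coplanar_triples:
  assumes "u \<noteq> 0" "u' \<noteq> 0"
    and "det (vector [u, u', v]) = 0" "det (vector [u, u', v']) = 0"
  shows "common_linear_factor (linear_form u * linear_form v) (linear_form u' * linear_form v')
       \<or> common_bivariate_form (linear_form u * linear_form v) (linear_form u' * linear_form v')"
proof (cases "\<exists>k. u' = k *s u")
  case True
  then obtain k where "u' = k *s u" by blast
  then have "linear_form u' * linear_form v' = linear_form u * linear_form (k *s v')"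
    by (simp add: linear_form_scale pscale_def algebra_simps)
  then show ?thesis unfolding common_linear_factor_def forms_1_3 by blast
next
  case False
  then obtain a b c d where v: "v = a *s u + b *s u'" and v': "v' = c *s u + d *s u'"
    using det_0_imp_in_span[of u u'] assms by blast
  have "linear_form u * linear_form v = subst2 (binary_quadratic a b 0) (linear_form u) (linear_form u')"
    by (simp add: v subst2_binary_quadratic linear_form_add linear_form_scale pscale_def Const_0 algebra_simps)
  moreover have "linear_form u' * linear_form v' = subst2 (binary_quadratic 0 c d) (linear_form u) (linear_form u')"
    by (simp add: v' subst2_binary_quadratic linear_form_add linear_form_scale pscale_def Const_0 algebra_simps)
  ultimately show ?thesis
    unfolding common_bivariate_form_iff forms_2_2 by blast
qed

text \<open>
  A vanishing bracket of the first product relates \<open>u, v\<close> to one of \<open>u', v'\<close>, and one of the second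
  product relates \<open>u', v'\<close> to one of \<open>u, v\<close>. The two triples thus share one factor of each form, and
  these two take the part of \<open>u, u'\<close> in \<open>two_coplanar_triples\<close>.
\<close>

lemma coplanar_cases:
  assumes "linear_form u * linear_form v \<noteq> 0" "linear_form u' * linear_form v' \<noteq> 0"
    and "det (vector [u, v, u']) * det (vector [u, v, v']) = 0"
    and "det (vector [u, u', v']) * det (vector [v, u', v']) = 0"
  shows "common_linear_factor (linear_form u * linear_form v) (linear_form u' * linear_form v')
       \<or> common_bivariate_form (linear_form u * linear_form v) (linear_form u' * linear_form v')"
proof -
  have nz: "u \<noteq> 0" "v \<noteq> 0" "u' \<noteq> 0" "v' \<noteq> 0"
    using assms(1,2) by (auto simp: linear_form_0)
  have "(det (vector [u, u', v]) = 0 \<or> det (vector [u, v', v]) = 0)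
      \<and> (det (vector [u, u', v']) = 0 \<or> det (vector [v, u', v']) = 0)"
    using assms(3,4) by (metis det_swap mult_eq_0_iff)
  then consider "det (vector [u, u', v]) = 0" "det (vector [u, u', v']) = 0"
    | "det (vector [v, u', u]) = 0" "det (vector [v, u', v']) = 0"
    | "det (vector [u, v', v]) = 0" "det (vector [u, v', u']) = 0"
    | "det (vector [v, v', u]) = 0" "det (vector [v, v', u']) = 0"
    by (metis det_swap det_rotate)
  then show ?thesis
    by cases (use nz two_coplanar_triples in \<open>metis mult.commute\<close>)+
qed

theorem theorem2p2:
  fixes p q :: cpoly and \<alpha> \<beta> :: "nat \<Rightarrow> complex"
  assumes "p \<in> forms 2 3" and "q \<in> forms 2 3"
    and "lin_indep p q"
    and "\<And>i j. i \<in> {1..4} \<Longrightarrow> j \<in> {1..4} \<Longrightarrow> i \<noteq> j \<Longrightarrow>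
           noncollinear (vector [\<alpha> i, \<beta> i]) (vector [\<alpha> j, \<beta> j])"
    and "\<And>i. i \<in> {1..4} \<Longrightarrow> factorizable (pscale (\<alpha> i) p + pscale (\<beta> i) q)"
  shows "(common_linear_factor p q \<or> common_bivariate_form p q) \<and>
         (\<forall>a b. factorizable (pscale a p + pscale b q))"
proof -
  define r where "r i = pscale (\<alpha> i) p + pscale (\<beta> i) q" for i
  define d where "d i j = \<alpha> i * \<beta> j - \<alpha> j * \<beta> i" for i j
  have d: "d i j \<noteq> 0" if "i \<in> {1..4}" "j \<in> {1..4}" "i \<noteq> j" for i j
    using noncollinear_det[OF assms(4)[OF that]] by (simp add: d_def)
  \<comment> \<open>If \<open>r i\<close> vanished, so would both coefficients of \<open>r i\<close>, and with them \<open>d i 3\<close>.\<close>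
  have r_nz: "r i \<noteq> 0" if "i \<in> {1, 2}" for i
  proof
    assume "r i = 0"
    then have "\<alpha> i = 0" "\<beta> i = 0"
      using assms(3) cpoly.independent_pairD unfolding lin_indep_def r_def by blast+
    then show False using d[of i 3] that by (auto simp: d_def)
  qed
  obtain u v u' v' where r1: "r 1 = linear_form u * linear_form v"
    and r2: "r 2 = linear_form u' * linear_form v'"
    using assms(5)[of 1] assms(5)[of 2] unfolding factorizable_def forms_1_3 r_def by auto
  let ?X = "det (vector [u, v, u']) * det (vector [u, v, v'])"
  let ?Y = "det (vector [u, u', v']) * det (vector [v, u', v'])"
  \<comment> \<open>By Cramer's rule, \<open>r\<^sub>k\<close> is up to the factor \<open>d 1 2\<close> the combination of \<open>r\<^sub>1\<close> and \<open>r\<^sub>2\<close> with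
    coefficients \<open>d k 2\<close> and \<open>d 1 k\<close>. Both are nonzero and can be cancelled from the discriminant.\<close>
  have eq: "d k 2 * ?X + d 1 k * ?Y = 0" if k: "k \<in> {3, 4}" for k
  proof -
    have "pscale (d 1 2) (r k) = pscale (d k 2) (r 1) + pscale (d 1 k) (r 2)"
      by (rule poly_mapping_eqI) (simp add: r_def d_def lookup_add algebra_simps)
    moreover have "discriminant (pscale (d 1 2) (r k)) = 0"
      using assms(5)[of k] k discriminant_factorizable factorizable_pscale unfolding r_def by auto
    ultimately have "- d k 2 * d 1 k * (d k 2 * ?X + d 1 k * ?Y) = 0"
      unfolding r1 r2 by (simp only: discriminant_pencil mult.assoc)
    then show ?thesis
      using d[of k 2] d[of 1 k] k by auto
  qed
  \<comment> \<open>A linear system for \<open>?X\<close> and \<open>?Y\<close> whose determinant is, by the Pluecker relation, \<open>d 1 2 * d 3 4\<close>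
    up to sign.\<close>
  have "d 1 2 * d 3 4 * ?X = 0 \<and> d 1 2 * d 3 4 * ?Y = 0"
    using eq[of 3] eq[of 4] unfolding d_def by (simp; algebra)
  then have "?X = 0" "?Y = 0" using d[of 1 2] d[of 3 4] by auto
  then have r12: "common_linear_factor (r 1) (r 2) \<or> common_bivariate_form (r 1) (r 2)"
    using coplanar_cases[of u v u' v'] r_nz[of 1] r_nz[of 2] unfolding r1 r2 by simp
  have "p = pscale (\<beta> 2 / d 1 2) (r 1) + pscale (- \<beta> 1 / d 1 2) (r 2)"
    "q = pscale (- \<alpha> 2 / d 1 2) (r 1) + pscale (\<alpha> 1 / d 1 2) (r 2)"
    using d[of 1 2]
    by (auto intro!: poly_mapping_eqI simp: r_def lookup_add field_simps)
      (simp_all add: d_def algebra_simps)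
  then have "common_linear_factor p q \<or> common_bivariate_form p q"
    using r12 common_linear_factor_pencil common_bivariate_form_pencil by metis
  then show ?thesis using factorizable_pencil by blast
qed

end
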